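(* For any probability laws $P_1,P_2$ on $\mathbb R$ with $F_{P_1},F_{P_2}\in\Gamma_F$ and every $\epsilon>0$, $$\|\Phi(P_1)-\Phi(P_2)\|_{\mathcal H_\epsilon}^2=\frac1{2\pi}\int_{\mathbb R}\frac{|\phi_{P_1}(\omega)-\phi_{P_2}(\omega)|^2}{\omega^2+\epsilon}\,d\omega,$$ and as $\epsilon\downarrow0$, $$\|\Phi(P_1)-\Phi(P_2)\|_{\mathcal H_\epsilon}\ \uparrow\ \Bigl(\frac1{2\pi}\int_{\mathbb R}\frac{|\phi_{P_1}(\omega)-\phi_{P_2}(\omega)|^2}{\omega^2}\,d\omega\Bigr)^{1/2}=d_C(P_1,P_2),$$ where $\uparrow$ means monotone nondecreasing convergence as $\epsilon$ decreases to $0$.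
   Context: $F_P$ and $\phi_P(\omega)=\mathbb E_{X\sim P}[e^{i\omega X}]$ are the cumulative distribution function (CDF) and characteristic function of a probability law $P$ on $\mathbb R$; $F_{\delta_0}(x)=\mathbf 1\{x\ge0\}$. $\Gamma_F$ is the set of CDFs $F$ with $F-F_{\delta_0}\in L^2(\mathbb R)$. The Cramér distance is $d_C(P_1,P_2)=\bigl(\int_{\mathbb R}(F_{P_1}(x)-F_{P_2}(x))^2dx\bigr)^{1/2}$. Fourier convention: $\widehat f(\omega)=\frac1{\sqrt{2\pi}}\int f(x)e^{-i\omega x}dx$. For $\epsilon>0$, $\mathcal H_\epsilon$ is the space of $f$ (tempered distributions, identified with their Fourier transforms $\widehat f$, which are measurable functions modulo a.e. equality) with $\|f\|_{\mathcal H_\epsilon}^2=\frac1{2\pi}\int_{\mathbb R}\frac{|\widehat f(\omega)|^2}{\omega^2+\epsilon}d\omega<\infty$. For a law $P$ with $F_P\in\Gamma_F$, $\Phi(P)\in\mathcal H_\epsilon$ is the element with Fourier transform $\widehat{\Phi(P)}(\omega)=\phi_P(\omega)-1$. *)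

theory Defs
  imports "HOL-Probability.Probability"
begin

text \<open>
  Laws on the real line are measures satisfying \<open>real_distribution\<close>; their CDF and characteristic
  function are the library's \<open>cdf\<close> and \<open>char\<close>.
\<close>

definition L2_real :: "(real \<Rightarrow> real) set" where
  "L2_real = {f. f \<in> borel_measurable lborel \<and> integrable lborel (\<lambda>x. (f x)\<^sup>2)}"

definition cdf_delta0 :: "real \<Rightarrow> real" where
  "cdf_delta0 x = (if x \<ge> 0 then 1 else 0)"

definition Gamma_F :: "(real \<Rightarrow> real) set" where
  "Gamma_F = {F. (\<exists>P. real_distribution P \<and> F = cdf P) \<and> (\<lambda>x. F x - cdf_delta0 x) \<in> L2_real}"

definition cramer_dist :: "real measure \<Rightarrow> real measure \<Rightarrow> real" where
  "cramer_dist P1 P2 = sqrt (LINT x|lborel. (cdf P1 x - cdf P2 x)\<^sup>2)"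

definition ae_eq :: "(real \<Rightarrow> complex) \<Rightarrow> (real \<Rightarrow> complex) \<Rightarrow> bool" where
  "ae_eq f g \<longleftrightarrow> f \<in> borel_measurable lborel \<and> g \<in> borel_measurable lborel \<and>
     (AE \<omega> in lborel. f \<omega> = g \<omega>)"

text \<open>
  A tempered distribution whose Fourier transform is a measurable function is identified with
  that Fourier transform modulo a.e. equality, so a term of type \<open>ae_fun\<close> stands for the
  distribution whose Fourier transform is the given class. For \<open>\<epsilon> > 0\<close>, every class with finite norm below is
  automatically the Fourier transform of a tempered distribution, because its product with a
  Schwartz function is integrable by Cauchy--Schwarz.
\<close>

quotient_type ae_fun = "real \<Rightarrow> complex" / partial: ae_eq
proof (rule part_equivpI)
  show "\<exists>f. ae_eq f f"
    by (rule exI[of _ "\<lambda>_. 0"]) (simp add: ae_eq_def)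
  show "symp ae_eq"
    by (auto simp: symp_def ae_eq_def elim: eventually_mono)
  show "transp ae_eq"
    by (auto simp: transp_def ae_eq_def elim: eventually_elim2)
qed

instantiation ae_fun :: minus
begin

lift_definition minus_ae_fun :: "ae_fun \<Rightarrow> ae_fun \<Rightarrow> ae_fun" is "\<lambda>f g \<omega>. f \<omega> - g \<omega>"
  by (auto simp: ae_eq_def elim: eventually_elim2)

instance ..

end

lemma ae_eq_weighted:
  assumes "ae_eq f g"
  shows "(\<lambda>\<omega>. (cmod (f \<omega>))\<^sup>2 / (\<omega>\<^sup>2 + \<epsilon>)) \<in> borel_measurable lborel"
    and "(\<lambda>\<omega>. (cmod (g \<omega>))\<^sup>2 / (\<omega>\<^sup>2 + \<epsilon>)) \<in> borel_measurable lborel"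
    and "AE \<omega> in lborel. (cmod (f \<omega>))\<^sup>2 / (\<omega>\<^sup>2 + \<epsilon>) = (cmod (g \<omega>))\<^sup>2 / (\<omega>\<^sup>2 + \<epsilon>)"
proof -
  have [measurable]: "f \<in> borel_measurable borel" "g \<in> borel_measurable borel"
    using assms by (auto simp: ae_eq_def)
  show "(\<lambda>\<omega>. (cmod (f \<omega>))\<^sup>2 / (\<omega>\<^sup>2 + \<epsilon>)) \<in> borel_measurable lborel"
    and "(\<lambda>\<omega>. (cmod (g \<omega>))\<^sup>2 / (\<omega>\<^sup>2 + \<epsilon>)) \<in> borel_measurable lborel"
    by measurable
  show "AE \<omega> in lborel. (cmod (f \<omega>))\<^sup>2 / (\<omega>\<^sup>2 + \<epsilon>) = (cmod (g \<omega>))\<^sup>2 / (\<omega>\<^sup>2 + \<epsilon>)"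
    using assms by (auto simp: ae_eq_def elim: eventually_mono)
qed

lift_definition H_member :: "real \<Rightarrow> ae_fun \<Rightarrow> bool" is
  "\<lambda>\<epsilon> f. integrable lborel (\<lambda>\<omega>. (cmod (f \<omega>))\<^sup>2 / (\<omega>\<^sup>2 + \<epsilon>))"
  by (intro integrable_cong_AE ae_eq_weighted)

definition H_space :: "real \<Rightarrow> ae_fun set" where
  "H_space \<epsilon> = {f. H_member \<epsilon> f}"

text \<open>The value is meaningful for members of \<open>H_space\<close>; it is 0 if the integral diverges.\<close>

lift_definition H_norm :: "real \<Rightarrow> ae_fun \<Rightarrow> real" is
  "\<lambda>\<epsilon> f. sqrt (1 / (2 * pi) * (LINT \<omega>|lborel. (cmod (f \<omega>))\<^sup>2 / (\<omega>\<^sup>2 + \<epsilon>)))"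
  by (intro arg_cong[where f = sqrt] arg_cong2[where f = "(*)"] refl integral_cong_AE ae_eq_weighted)

text \<open>\<open>Phi P\<close> is intended for laws \<open>P\<close>, where \<open>char P\<close> is continuous and hence measurable.\<close>

definition Phi :: "real measure \<Rightarrow> ae_fun" where
  "Phi P = abs_ae_fun (\<lambda>\<omega>. char P \<omega> - 1)"

end

theory Submission
  imports Defs "HOL-Real_Asymp.Real_Asymp"
begin

text \<open>
  Write \<open>G = F\<^sub>1 - F\<^sub>2\<close>, \<open>\<psi> = \<phi>\<^sub>1 - \<phi>\<^sub>2\<close> and \<open>D h = \<integral> (G (x + h) - G x)\<^sup>2 dx\<close>. No Plancherel theorem and no moment
  assumption is needed: the kernel \<open>(1 - cos (h \<omega>)) / \<omega>\<^sup>2\<close> is integrable with Fourier transform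
  \<open>\<pi> max 0 (h - \<bar>z\<bar>)\<close>, and \<open>max 0 (h - \<bar>s - t\<bar>)\<close> is also the length of \<open>{x. s, t \<in> (x, x + h]}\<close>, so
  Fubini gives \<open>\<integral> \<bar>\<psi>\<bar>\<^sup>2 (1 - cos (h \<omega>)) / \<omega>\<^sup>2 d\<omega> = \<pi> D h\<close>. Putting \<open>h = u / a\<close> and averaging against
  \<open>exp (- u) du\<close> on \<open>u \<ge> 0\<close> turns the left kernel into exactly \<open>1 / (\<omega>\<^sup>2 + a\<^sup>2)\<close>. As \<open>a\<close> tends to 0, the left
  side increases to \<open>\<integral> \<bar>\<psi>\<bar>\<^sup>2 / \<omega>\<^sup>2 d\<omega>\<close>, and the right side tends to \<open>2 \<pi> \<integral> G\<^sup>2\<close>, since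
  \<open>D h\<close> tends to \<open>2 \<integral> G\<^sup>2\<close> for square-integrable \<open>G\<close>.
\<close>

section \<open>Integrals of the cosine kernel\<close>

text \<open>The explicit primitive \<open>F\<close> vanishes at infinity, so the value is
  \<open>- F 0 = 1 / t - t / (t\<^sup>2 + b\<^sup>2)\<close>. It serves twice: as an inner integral
  in the evaluation of the kernel integral, and at \<open>t = 1\<close> to produce the weight
  \<open>1 / (w\<^sup>2 + a\<^sup>2)\<close>.\<close>

lemma nn_integral_exp_one_minus_cos:
  fixes t b :: real
  assumes "t > 0"
  shows "(\<integral>\<^sup>+u. ennreal (exp (- (t * u)) * (1 - cos (b * u))) * indicator {0..} u \<partial>lborel)
    = ennreal (b\<^sup>2 / (t * (t\<^sup>2 + b\<^sup>2)))"
proof -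
  define F where "F u = exp (- (t * u)) * ((t * cos (b * u) - b * sin (b * u)) / (t\<^sup>2 + b\<^sup>2) - 1 / t)"
    for u
  have pos: "t\<^sup>2 + b\<^sup>2 > 0"
    using assms by (simp add: add_pos_nonneg)
  have "(\<integral>\<^sup>+u. ennreal (exp (- (t * u)) * (1 - cos (b * u))) * indicator {0..} u \<partial>lborel)
      = ennreal (0 - F 0)"
  proof (rule nn_integral_FTC_atLeast)
    show "(F has_real_derivative exp (- (t * u)) * (1 - cos (b * u))) (at u)" for u
    proof -
      \<comment> \<open>With the reciprocal named, the derivative is polynomial in \<open>k\<close>,
        and the denominator cancels through the single equation \<open>k\<close>.\<close>
      define k where "k = 1 / (t\<^sup>2 + b\<^sup>2)"
      have k: "k * (t\<^sup>2 + b\<^sup>2) = 1"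
        using pos assms by (simp add: k_def)
      have "((\<lambda>u. exp (- (t * u)) * ((t * cos (b * u) - b * sin (b * u)) * k - 1 / t)) has_real_derivative
          exp (- (t * u)) * (- t) * ((t * cos (b * u) - b * sin (b * u)) * k - 1 / t)
          + exp (- (t * u)) * ((- t * b * sin (b * u) - b * b * cos (b * u)) * k)) (at u)"
        by (rule derivative_eq_intros refl)+ (simp add: algebra_simps)
      moreover have "exp (- (t * u)) * (- t) * ((t * cos (b * u) - b * sin (b * u)) * k - 1 / t)
          + exp (- (t * u)) * ((- t * b * sin (b * u) - b * b * cos (b * u)) * k)
          = exp (- (t * u)) * (t * (1 / t) - (k * (t\<^sup>2 + b\<^sup>2)) * cos (b * u))"
        by (simp add: algebra_simps power2_eq_square)
      ultimately show ?thesis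
        using assms by (simp add: k F_def[abs_def]) (simp add: k_def)
    qed
    have "((\<lambda>u. exp (- (t * u))) \<longlongrightarrow> 0) at_top"
      using assms by real_asymp
    moreover have "\<bar>(t * cos (b * u) - b * sin (b * u)) / (t\<^sup>2 + b\<^sup>2) - 1 / t\<bar>
        \<le> (t + \<bar>b\<bar>) / (t\<^sup>2 + b\<^sup>2) + 1 / t" for u
    proof -
      have "\<bar>t * cos (b * u) - b * sin (b * u)\<bar> \<le> \<bar>t\<bar> * \<bar>cos (b * u)\<bar> + \<bar>b\<bar> * \<bar>sin (b * u)\<bar>"
        using abs_triangle_ineq4[of "t * cos (b * u)" "b * sin (b * u)"] by (simp add: abs_mult)
      also have "\<dots> \<le> t + \<bar>b\<bar>"
        using assms by (intro add_mono mult_left_le) auto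
      finally have "\<bar>(t * cos (b * u) - b * sin (b * u)) / (t\<^sup>2 + b\<^sup>2)\<bar> \<le> (t + \<bar>b\<bar>) / (t\<^sup>2 + b\<^sup>2)"
        using pos by (simp add: divide_right_mono)
      moreover have "\<bar>1 / t\<bar> = 1 / t" using assms by simp
      ultimately show ?thesis by linarith
    qed
    ultimately show "(F \<longlongrightarrow> 0) at_top"
      unfolding F_def by (intro lim_null_mult_right_bounded[where B = "(t + \<bar>b\<bar>) / (t\<^sup>2 + b\<^sup>2) + 1 / t"]) auto
  qed auto
  also have "0 - F 0 = b\<^sup>2 / (t * (t\<^sup>2 + b\<^sup>2))"
    using assms pos by (simp add: F_def field_simps) (simp add: power2_eq_square)
  finally show ?thesis .
qed

text \<open>This Laplace representation of \<open>1 / w\<^sup>2\<close> replaces the singular factor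
  of the kernel by an integral whose order can be exchanged.\<close>

lemma nn_integral_mult_exp:
  fixes w :: real
  assumes "w > 0"
  shows "(\<integral>\<^sup>+t. ennreal (t * exp (- (t * w))) * indicator {0..} t \<partial>lborel) = ennreal (1 / w\<^sup>2)"
proof -
  define F where "F t = - (t / w + 1 / w\<^sup>2) * exp (- (t * w))" for t
  have "(\<integral>\<^sup>+t. ennreal (t * exp (- (t * w))) * indicator {0..} t \<partial>lborel) = ennreal (0 - F 0)"
  proof (rule nn_integral_FTC_atLeast)
    show "(F has_real_derivative t * exp (- (t * w))) (at t)" for t
    proof -
      have "((\<lambda>t. - (t * (1 / w) + 1 / w\<^sup>2) * exp (- (t * w))) has_real_derivative
          - (1 / w) * exp (- (t * w)) + (- (t * (1 / w) + 1 / w\<^sup>2)) * (exp (- (t * w)) * - w)) (at t)"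
        by (rule derivative_eq_intros refl)+ simp
      moreover have "- (1 / w) * exp (- (t * w)) + (- (t * (1 / w) + 1 / w\<^sup>2)) * (exp (- (t * w)) * - w)
          = t * exp (- (t * w))"
        using assms by (simp add: field_simps power2_eq_square)
      ultimately show ?thesis by (simp add: F_def[abs_def])
    qed
    show "(F \<longlongrightarrow> 0) at_top"
      unfolding F_def using assms by real_asymp
  qed auto
  then show ?thesis by (simp add: F_def)
qed

text \<open>Write \<open>1 / w\<^sup>2\<close> as a Laplace integral in \<open>t\<close> and
  exchange the two nonnegative integrals. The integral over \<open>w\<close> becomes
  \<open>c\<^sup>2 / (t\<^sup>2 + c\<^sup>2)\<close>, whose primitive
  \<open>c * arctan (t / c)\<close> rises from 0 to \<open>c * pi / 2\<close>.\<close>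

lemma nn_integral_one_minus_cos_div_square_pos:
  fixes c :: real
  assumes "c > 0"
  shows "(\<integral>\<^sup>+w. ennreal ((1 - cos (c * w)) / w\<^sup>2) * indicator {0..} w \<partial>lborel) = ennreal (pi * c / 2)"
proof -
  have nz: "AE w in lborel. w \<noteq> (0::real)"
    by (rule AE_lborel_singleton)
  have "(\<integral>\<^sup>+w. ennreal ((1 - cos (c * w)) / w\<^sup>2) * indicator {0..} w \<partial>lborel)
      = (\<integral>\<^sup>+w. (\<integral>\<^sup>+t. ennreal (t * exp (- (t * w)) * (1 - cos (c * w))) * indicator {0..} t * indicator {0..} w \<partial>lborel) \<partial>lborel)"
  proof (rule nn_integral_cong_AE, use nz in eventually_elim)
    case (elim w)
    show ?case
    proof (cases "w > 0")
      case True
      have "(\<integral>\<^sup>+t. ennreal (t * exp (- (t * w)) * (1 - cos (c * w))) * indicator {0..} t * indicator {0..} w \<partial>lborel)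
          = (\<integral>\<^sup>+t. ennreal (1 - cos (c * w)) * (ennreal (t * exp (- (t * w))) * indicator {0..} t) \<partial>lborel)"
        using True by (intro nn_integral_cong)
          (auto simp: ennreal_mult[symmetric] mult.commute split: split_indicator)
      also have "\<dots> = ennreal (1 - cos (c * w)) * ennreal (1 / w\<^sup>2)"
        using True by (subst nn_integral_cmult) (auto simp: nn_integral_mult_exp)
      finally show ?thesis
        using True by (simp add: ennreal_mult[symmetric])
    qed (use elim in \<open>simp add: not_less\<close>)
  qed
  also have "\<dots> = (\<integral>\<^sup>+t. (\<integral>\<^sup>+w. ennreal (t * exp (- (t * w)) * (1 - cos (c * w))) * indicator {0..} t * indicator {0..} w \<partial>lborel) \<partial>lborel)"
    by (rule lborel_pair.Fubini') measurable
  also have "\<dots> = (\<integral>\<^sup>+t. ennreal (c\<^sup>2 / (t\<^sup>2 + c\<^sup>2)) * indicator {0..} t \<partial>lborel)"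
  \<comment> \<open>The integrands really differ at \<open>t = 0\<close>, where the left one is 0
    and the right one is 1.\<close>
  proof (rule nn_integral_cong_AE, use nz in eventually_elim)
    case (elim t)
    show ?case
    proof (cases "t > 0")
      case True
      have "(\<integral>\<^sup>+w. ennreal (t * exp (- (t * w)) * (1 - cos (c * w))) * indicator {0..} t * indicator {0..} w \<partial>lborel)
          = (\<integral>\<^sup>+w. ennreal t * (ennreal (exp (- (t * w)) * (1 - cos (c * w))) * indicator {0..} w) \<partial>lborel)"
        using True by (intro nn_integral_cong)
          (auto simp: ennreal_mult[symmetric] mult.assoc split: split_indicator)
      also have "\<dots> = ennreal t * ennreal (c\<^sup>2 / (t * (t\<^sup>2 + c\<^sup>2)))"
        using True by (subst nn_integral_cmult) (auto simp: nn_integral_exp_one_minus_cos)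
      also have "\<dots> = ennreal (c\<^sup>2 / (t\<^sup>2 + c\<^sup>2))"
        using True by (simp add: ennreal_mult[symmetric])
      finally show ?thesis using True by simp
    qed (use elim in \<open>simp add: not_less\<close>)
  qed
  also have "\<dots> = ennreal (c * (pi / 2) - c * arctan (0 / c))"
  proof (rule nn_integral_FTC_atLeast)
    show "((\<lambda>t. c * arctan (t / c)) has_real_derivative c\<^sup>2 / (t\<^sup>2 + c\<^sup>2)) (at t)" for t
    proof -
      have "((\<lambda>t. c * arctan (t / c)) has_real_derivative c * (inverse (1 + (t / c)\<^sup>2) * (1 / c))) (at t)"
        by (intro DERIV_cmult DERIV_chain2[OF DERIV_arctan] DERIV_cdivide DERIV_ident)
      moreover have "c * (inverse (1 + (t / c)\<^sup>2) * (1 / c)) = c\<^sup>2 / (t\<^sup>2 + c\<^sup>2)"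
      proof -
        have "1 + (t / c)\<^sup>2 = (t\<^sup>2 + c\<^sup>2) / c\<^sup>2"
          using assms by (simp add: field_simps)
        then show ?thesis
          using assms by simp
      qed
      ultimately show ?thesis by simp
    qed
    have "filterlim (\<lambda>t. t / c) at_top at_top"
      using assms by real_asymp
    then show "((\<lambda>t. c * arctan (t / c)) \<longlongrightarrow> c * (pi / 2)) at_top"
      by (intro tendsto_intros filterlim_compose[OF tendsto_arctan_at_top])
  qed auto
  finally show ?thesis by (simp add: mult.commute)
qed

text \<open>The integrand is even in both \<open>w\<close> and \<open>c\<close>, so the integral is
  twice the half-line value at \<open>\<bar>c\<bar>\<close>.\<close>

lemma nn_integral_one_minus_cos_div_square:
  fixes c :: real
  shows "(\<integral>\<^sup>+w. ennreal ((1 - cos (c * w)) / w\<^sup>2) \<partial>lborel) = ennreal (pi * \<bar>c\<bar>)"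
proof (cases "c = 0")
  case False
  let ?f = "\<lambda>w. ennreal ((1 - cos (\<bar>c\<bar> * w)) / w\<^sup>2)"
  let ?I = "\<integral>\<^sup>+w. ?f w * indicator {0..} w \<partial>lborel"
  have I: "?I = ennreal (pi * \<bar>c\<bar> / 2)"
    using False by (intro nn_integral_one_minus_cos_div_square_pos) simp
  have "(\<integral>\<^sup>+w. ennreal ((1 - cos (c * w)) / w\<^sup>2) \<partial>lborel) = (\<integral>\<^sup>+w. ?f w \<partial>lborel)"
    by (intro nn_integral_cong) (auto simp: abs_if)
  also have "\<dots> = (\<integral>\<^sup>+w. ?f w * indicator {0..} w + ?f w * indicator {..0} w \<partial>lborel)"
    by (intro nn_integral_cong_AE, use AE_lborel_singleton[of 0] in eventually_elim)
      (auto split: split_indicator)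
  also have "\<dots> = ?I + (\<integral>\<^sup>+w. ?f w * indicator {..0} w \<partial>lborel)"
    by (rule nn_integral_add) auto
  also have "(\<integral>\<^sup>+w. ?f w * indicator {..0} w \<partial>lborel) = ?I"
    by (subst nn_integral_real_affine[where c = "-1" and t = 0])
      (auto intro!: nn_integral_cong split: split_indicator)
  finally show ?thesis
    unfolding I by (simp add: ennreal_plus[symmetric] del: ennreal_plus)
qed simp

lemma has_bochner_integral_one_minus_cos_div_square:
  "has_bochner_integral lborel (\<lambda>w. (1 - cos (c * w)) / w\<^sup>2) (pi * \<bar>c\<bar>)" for c :: real
  by (rule has_bochner_integral_nn_integral) (auto simp: nn_integral_one_minus_cos_div_square)

text \<open>The product formula for cosines splits the integrand into half the kernels at
  \<open>z + h\<close> and \<open>z - h\<close> minus the kernel at \<open>z\<close>. The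
  corresponding combination of absolute values is the tent function.\<close>

lemma has_bochner_integral_cos_one_minus_cos_div_square:
  fixes h z :: real
  assumes "h \<ge> 0"
  shows "has_bochner_integral lborel (\<lambda>w. cos (w * z) * ((1 - cos (h * w)) / w\<^sup>2)) (pi * max 0 (h - \<bar>z\<bar>))"
proof -
  let ?k = "\<lambda>c w. (1 - cos (c * w)) / w\<^sup>2 :: real"
  have "has_bochner_integral lborel (\<lambda>w. 1 / 2 * ?k (z + h) w + 1 / 2 * ?k (z - h) w - ?k z w)
     (1 / 2 * (pi * \<bar>z + h\<bar>) + 1 / 2 * (pi * \<bar>z - h\<bar>) - pi * \<bar>z\<bar>)"
    by (intro has_bochner_integral_diff has_bochner_integral_add has_bochner_integral_mult_right
        has_bochner_integral_one_minus_cos_div_square)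
  moreover have "1 / 2 * ?k (z + h) w + 1 / 2 * ?k (z - h) w - ?k z w = cos (w * z) * ?k h w" for w
  proof -
    have "1 / 2 * (1 - cos ((z + h) * w)) + 1 / 2 * (1 - cos ((z - h) * w)) - (1 - cos (z * w))
        = cos (w * z) * (1 - cos (h * w))"
      by (simp add: ring_distribs left_diff_distrib cos_add cos_diff mult.commute)
    then show ?thesis
      by (simp only: times_divide_eq_right add_divide_distrib[symmetric] diff_divide_distrib[symmetric])
  qed
  moreover have "1 / 2 * (pi * \<bar>z + h\<bar>) + 1 / 2 * (pi * \<bar>z - h\<bar>) - pi * \<bar>z\<bar> = pi * max 0 (h - \<bar>z\<bar>)"
  proof -
    have "1 / 2 * \<bar>z + h\<bar> + 1 / 2 * \<bar>z - h\<bar> - \<bar>z\<bar> = max 0 (h - \<bar>z\<bar>)"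
      using assms by (auto simp: max_def abs_if field_simps)
    from arg_cong[OF this, of "(*) pi"] show ?thesis
      by (simp add: algebra_simps)
  qed
  ultimately show ?thesis by simp
qed

section \<open>Characteristic functions against integrable kernels\<close>

lemma (in real_distribution) Re_char: "Re (char M w) = (LINT x|M. cos (w * x))"
proof -
  have "integrable M (\<lambda>x. iexp (w * x))"
    by (intro integrable_iexp) auto
  then have "Re (char M w) = (LINT x|M. Re (iexp (w * x)))"
    unfolding char_def by (simp del: Re_exp)
  then show ?thesis by (simp add: Re_exp)
qed

text \<open>A Parseval-type exchange by Fubini: the integrand is dominated by
  \<open>\<bar>k w\<bar>\<close> uniformly in \<open>z\<close>, and \<open>M\<close> has total mass
  1.\<close>

lemma (in real_distribution) has_bochner_integral_Re_char_mult:
  fixes k :: "real \<Rightarrow> real"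
  assumes k: "integrable lborel k"
  shows "has_bochner_integral lborel (\<lambda>w. Re (char M w) * k w)
    (LINT z|M. (LINT w|lborel. cos (w * z) * k w))"
proof -
  interpret pair_sigma_finite M lborel ..
  have [measurable]: "k \<in> borel_measurable borel"
    using k by auto
  have int: "integrable (M \<Otimes>\<^sub>M lborel) (\<lambda>(z, w). cos (w * z) * k w)"
  proof (rule Fubini_integrable)
    have "integrable lborel (\<lambda>w. cos (w * z) * k w)" for z
      by (rule Bochner_Integration.integrable_bound[OF k]) (auto simp: abs_mult intro!: mult_left_le_one_le)
    then show "AE z in M. integrable lborel (\<lambda>w. case (z, w) of (z, w) \<Rightarrow> cos (w * z) * k w)"
      by simp
    have "norm (LINT w|lborel. norm (cos (w * z) * k w)) \<le> (LINT w|lborel. norm (k w))" for z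
      using k by (simp, intro integral_mono' Bochner_Integration.integrable_abs)
        (auto simp: abs_mult intro!: mult_left_le_one_le)
    then show "integrable M (\<lambda>z. LINT w|lborel. norm (case (z, w) of (z, w) \<Rightarrow> cos (w * z) * k w))"
      by (intro integrable_const_bound[where B = "LINT w|lborel. norm (k w)"]) auto
  qed simp
  show ?thesis
    unfolding has_bochner_integral_iff
    using integrable_snd[OF int] Fubini_integral[OF int] by (simp add: Re_char)
qed

lemma (in real_distribution) borel_measurable_cdf [measurable]: "cdf M \<in> borel_measurable borel"
  by (intro borel_measurable_mono monoI cdf_nondecreasing)

section \<open>Independent differences and overlaps of intervals\<close>

text \<open>The law of X - Y for independent X and Y with laws \<open>P\<close> and
  \<open>Q\<close>. It makes each product \<open>char P w * cnj (char Q w)\<close> a single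
  characteristic function.\<close>

definition diff_law :: "real measure \<Rightarrow> real measure \<Rightarrow> real measure" where
  "diff_law P Q = distr (P \<Otimes>\<^sub>M Q) borel (\<lambda>(s, t). s - t)"

text \<open>The laws may coincide: the instances at (P, P), (Q, Q) and (P, Q) supply the terms of an
  expanded square.\<close>

locale real_distribution_pair =
  P: real_distribution P + Q: real_distribution Q for P Q
begin

sublocale PQ: pair_prob_space P Q ..

lemma measurable_diff [measurable]: "(\<lambda>(s, t). s - t) \<in> borel_measurable (P \<Otimes>\<^sub>M Q)"
  by measurable

sublocale D: real_distribution "diff_law P Q"
  unfolding diff_law_def by (rule PQ.real_distribution_distr) measurable

lemma char_diff_law: "char (diff_law P Q) w = char P w * cnj (char Q w)"
proof -
  have P: "integrable P (\<lambda>x. iexp (w * x))" and Q: "integrable Q (\<lambda>x. iexp (- (w * x)))"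
    using P.integrable_iexp[of "\<lambda>x. of_real (w * x)"] Q.integrable_iexp[of "\<lambda>x. of_real (- (w * x))"]
    by auto
  have int: "integrable (P \<Otimes>\<^sub>M Q) (\<lambda>z. iexp (w * fst z) * iexp (- (w * snd z)))"
    using PQ.integrable_iexp[of "\<lambda>z. of_real (w * fst z - w * snd z)"]
    by (simp add: exp_diff exp_minus field_simps exp_add[symmetric])
  have "char (diff_law P Q) w = (CLINT z|P \<Otimes>\<^sub>M Q. iexp (w * fst z) * iexp (- (w * snd z)))"
    unfolding char_def diff_law_def
    by (subst integral_distr) (auto simp: exp_add[symmetric] algebra_simps split_beta)
  also have "\<dots> = (CLINT s|P. (CLINT t|Q. iexp (w * s) * iexp (- (w * t))))"
    using PQ.integral_fst'[OF int] by simp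
  also have "\<dots> = (CLINT s|P. iexp (w * s)) * (CLINT t|Q. iexp (- (w * t)))"
    by simp
  also have "(CLINT t|Q. iexp (- (w * t))) = cnj (CLINT t|Q. iexp (w * t))"
    by (subst Bochner_Integration.integral_cnj[symmetric]) (simp add: exp_cnj)
  finally show ?thesis by (simp add: char_def)
qed

text \<open>Both sides measure the set \<open>B\<close> of triples (x, s, t) with s and t in
  \<open>{x<..x + h}\<close>. Its sections at fixed x are squares; those at fixed (s, t) are
  intervals of length \<open>max 0 (h - \<bar>s - t\<bar>)\<close>.\<close>

lemma nn_integral_measure_Ioc_mult:
  assumes h: "h \<ge> 0"
  shows "(\<integral>\<^sup>+x. ennreal (measure P {x<..x + h} * measure Q {x<..x + h}) \<partial>lborel)
    = (\<integral>\<^sup>+z. ennreal (max 0 (h - \<bar>z\<bar>)) \<partial>diff_law P Q)"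
proof -
  interpret L: pair_sigma_finite lborel "P \<Otimes>\<^sub>M Q" ..
  define B where "B = {(x :: real, (s, t)). x < s \<and> s \<le> x + h \<and> x < t \<and> t \<le> x + h}"
  have B: "B \<in> sets (lborel \<Otimes>\<^sub>M (P \<Otimes>\<^sub>M Q))"
  proof -
    have "{z \<in> space (lborel \<Otimes>\<^sub>M (P \<Otimes>\<^sub>M Q)). fst z < fst (snd z) \<and> fst (snd z) \<le> fst z + h \<and>
        fst z < snd (snd z) \<and> snd (snd z) \<le> fst z + h} \<in> sets (lborel \<Otimes>\<^sub>M (P \<Otimes>\<^sub>M Q))"
      by measurable
    also have "{z \<in> space (lborel \<Otimes>\<^sub>M (P \<Otimes>\<^sub>M Q)). fst z < fst (snd z) \<and> fst (snd z) \<le> fst z + h \<and>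
        fst z < snd (snd z) \<and> snd (snd z) \<le> fst z + h} = B"
      by (auto simp: B_def space_pair_measure)
    finally show ?thesis .
  qed
  have "(\<integral>\<^sup>+x. ennreal (measure P {x<..x + h} * measure Q {x<..x + h}) \<partial>lborel)
      = (\<integral>\<^sup>+x. emeasure (P \<Otimes>\<^sub>M Q) (Pair x -` B) \<partial>lborel)"
  proof (rule nn_integral_cong)
    fix x
    have "Pair x -` B = {x<..x + h} \<times> {x<..x + h}"
      by (auto simp: B_def)
    then show "ennreal (measure P {x<..x + h} * measure Q {x<..x + h}) = emeasure (P \<Otimes>\<^sub>M Q) (Pair x -` B)"
      by (simp add: Q.emeasure_pair_measure_Times P.emeasure_eq_measure Q.emeasure_eq_measure ennreal_mult)
  qed
  also have "\<dots> = emeasure (lborel \<Otimes>\<^sub>M (P \<Otimes>\<^sub>M Q)) B"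
    by (rule PQ.emeasure_pair_measure_alt[symmetric, OF B])
  also have "\<dots> = (\<integral>\<^sup>+z. emeasure lborel ((\<lambda>x. (x, z)) -` B) \<partial>(P \<Otimes>\<^sub>M Q))"
    by (rule L.emeasure_pair_measure_alt2[OF B])
  also have "\<dots> = (\<integral>\<^sup>+z. ennreal (max 0 (h - \<bar>fst z - snd z\<bar>)) \<partial>(P \<Otimes>\<^sub>M Q))"
  proof (rule nn_integral_cong)
    fix z :: "real \<times> real"
    \<comment> \<open>Solving for \<open>x\<close> reverses the half-open end: the interval is
      closed on the left, and empty when the two points are at least \<open>h\<close> apart.\<close>
    have "(\<lambda>x. (x, z)) -` B = {max (fst z) (snd z) - h ..< min (fst z) (snd z)}"
      by (auto simp: B_def split_beta)
    moreover have "emeasure lborel {a..<b} = ennreal (max 0 (b - a))" for a b :: real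
      by (cases "a \<le> b") auto
    moreover have "min (fst z) (snd z) - (max (fst z) (snd z) - h) = h - \<bar>fst z - snd z\<bar>"
      by linarith
    ultimately show "emeasure lborel ((\<lambda>x. (x, z)) -` B) = ennreal (max 0 (h - \<bar>fst z - snd z\<bar>))"
      by presburger
  qed
  also have "\<dots> = (\<integral>\<^sup>+z. ennreal (max 0 (h - \<bar>z\<bar>)) \<partial>diff_law P Q)"
    unfolding diff_law_def by (subst nn_integral_distr) (auto simp: split_beta)
  finally show ?thesis .
qed

lemma measure_Ioc_left: "h \<ge> 0 \<Longrightarrow> measure P {x<..x + h} = cdf P (x + h) - cdf P x"
  using P.cdf_diff_eq[of x "x + h"] by (cases "h = 0") auto

lemma measure_Ioc_right: "h \<ge> 0 \<Longrightarrow> measure Q {x<..x + h} = cdf Q (x + h) - cdf Q x"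
  using Q.cdf_diff_eq[of x "x + h"] by (cases "h = 0") auto

text \<open>The link between the two sides: it is the correlation of the CDF increments and, up to
  the factor \<open>pi\<close>, the kernel integral of the characteristic functions.\<close>

definition overlap :: "real \<Rightarrow> real" where
  "overlap h = (LINT z|diff_law P Q. max 0 (h - \<bar>z\<bar>))"

lemma has_bochner_integral_cdf_increments:
  assumes h: "h \<ge> 0"
  shows "has_bochner_integral lborel
    (\<lambda>x. (cdf P (x + h) - cdf P x) * (cdf Q (x + h) - cdf Q x)) (overlap h)"
proof (rule has_bochner_integral_nn_integral)
  have "integrable (diff_law P Q) (\<lambda>z. max 0 (h - \<bar>z\<bar>))"
    using h by (intro D.integrable_const_bound[where B = h]) auto
  then have "(\<integral>\<^sup>+z. ennreal (max 0 (h - \<bar>z\<bar>)) \<partial>diff_law P Q) = ennreal (overlap h)"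
    unfolding overlap_def by (intro nn_integral_eq_integral) auto
  then show "(\<integral>\<^sup>+x. ennreal ((cdf P (x + h) - cdf P x) * (cdf Q (x + h) - cdf Q x)) \<partial>lborel)
      = ennreal (overlap h)"
    using nn_integral_measure_Ioc_mult[OF h] h by (simp add: measure_Ioc_left measure_Ioc_right)
  show "AE x in lborel. 0 \<le> (cdf P (x + h) - cdf P x) * (cdf Q (x + h) - cdf Q x)"
    using h P.cdf_nondecreasing Q.cdf_nondecreasing by (intro AE_I2 mult_nonneg_nonneg) auto
  show "0 \<le> overlap h"
    unfolding overlap_def by (intro integral_nonneg_AE) auto
qed measurable

text \<open>Exchanging integrals against the difference law leaves the cosine transform of the
  kernel, a tent, under the expectation.\<close>

lemma has_bochner_integral_char_overlap:
  assumes h: "h \<ge> 0"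
  shows "has_bochner_integral lborel
    (\<lambda>w. Re (char P w * cnj (char Q w)) * ((1 - cos (h * w)) / w\<^sup>2)) (pi * overlap h)"
proof -
  have k: "integrable lborel (\<lambda>w. (1 - cos (h * w)) / w\<^sup>2)"
    using has_bochner_integral_one_minus_cos_div_square[of h] by (simp add: has_bochner_integral_iff)
  have "(LINT w|lborel. cos (w * z) * ((1 - cos (h * w)) / w\<^sup>2)) = pi * max 0 (h - \<bar>z\<bar>)" for z
    using has_bochner_integral_cos_one_minus_cos_div_square[OF h] by (simp add: has_bochner_integral_iff)
  with D.has_bochner_integral_Re_char_mult[OF k] show ?thesis
    by (simp add: char_diff_law overlap_def)
qed

end

section \<open>The shift identity and its exponential average\<close>

text \<open>The squared L2 distance between \<open>g\<close> and its translate, written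
  \<open>D h\<close> in the overview.\<close>

definition shift_energy :: "(real \<Rightarrow> real) \<Rightarrow> real \<Rightarrow> real" where
  "shift_energy g h = (LINT x|lborel. (g (x + h) - g x)\<^sup>2)"

text \<open>Expanding the square on either side gives the same combination \<open>?E\<close> of
  three overlaps, with the extra factor \<open>pi\<close> on the frequency side.\<close>

lemma has_bochner_integral_char_diff:
  assumes "real_distribution P" "real_distribution Q" and h: "h \<ge> 0"
  shows "has_bochner_integral lborel
    (\<lambda>w. (cmod (char P w - char Q w))\<^sup>2 * ((1 - cos (h * w)) / w\<^sup>2))
    (pi * shift_energy (\<lambda>x. cdf P x - cdf Q x) h)"
proof -
  interpret PP: real_distribution_pair P P using assms by (simp add: real_distribution_pair_def)
  interpret QQ: real_distribution_pair Q Q using assms by (simp add: real_distribution_pair_def)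
  interpret PQ: real_distribution_pair P Q using assms by (simp add: real_distribution_pair_def)
  let ?E = "PP.overlap h + QQ.overlap h - 2 * PQ.overlap h"
  let ?p = "\<lambda>x. cdf P (x + h) - cdf P x" and ?q = "\<lambda>x. cdf Q (x + h) - cdf Q x"
  have "has_bochner_integral lborel (\<lambda>x. ?p x * ?p x + ?q x * ?q x - 2 * (?p x * ?q x)) ?E"
    using h by (intro has_bochner_integral_diff has_bochner_integral_add has_bochner_integral_mult_right
        PP.has_bochner_integral_cdf_increments QQ.has_bochner_integral_cdf_increments
        PQ.has_bochner_integral_cdf_increments)
  moreover have "?p x * ?p x + ?q x * ?q x - 2 * (?p x * ?q x)
      = (cdf P (x + h) - cdf Q (x + h) - (cdf P x - cdf Q x))\<^sup>2" for x
    by (simp add: power2_eq_square algebra_simps)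
  ultimately have E: "shift_energy (\<lambda>x. cdf P x - cdf Q x) h = ?E"
    by (simp add: shift_energy_def has_bochner_integral_iff)
  let ?r = "\<lambda>P Q w. Re (char P w * cnj (char Q w)) * ((1 - cos (h * w)) / w\<^sup>2)"
  have "has_bochner_integral lborel (\<lambda>w. ?r P P w + ?r Q Q w - 2 * ?r P Q w)
      (pi * PP.overlap h + pi * QQ.overlap h - 2 * (pi * PQ.overlap h))"
    using h by (intro has_bochner_integral_diff has_bochner_integral_add has_bochner_integral_mult_right
        PP.has_bochner_integral_char_overlap QQ.has_bochner_integral_char_overlap
        PQ.has_bochner_integral_char_overlap)
  moreover have "?r P P w + ?r Q Q w - 2 * ?r P Q w
      = (cmod (char P w - char Q w))\<^sup>2 * ((1 - cos (h * w)) / w\<^sup>2)" for w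
  proof -
    have "Re (char P w * cnj (char P w)) + Re (char Q w * cnj (char Q w)) - 2 * Re (char P w * cnj (char Q w))
      = (cmod (char P w - char Q w))\<^sup>2"
      by (simp only: cmod_power2) (simp add: power2_eq_square algebra_simps)
    then show ?thesis
      by (metis (no_types, lifting) left_diff_distrib distrib_right mult.assoc)
  qed
  ultimately show ?thesis
    unfolding E by (simp add: algebra_simps)
qed

text \<open>Take \<open>h = u / a\<close> in the shift identity and average against
  \<open>exp (- u)\<close>. Assumption \<open>int\<close> makes the resulting nonnegative integral a
  finite Bochner integral; for square-integrable CDF differences it follows from boundedness of the
  shift energy.\<close>

lemma has_bochner_integral_char_diff_regularized:
  assumes "real_distribution P" "real_distribution Q" and a: "a > 0"
    and int: "integrable lborel (\<lambda>u. exp (- u) * indicator {0..} u * shift_energy (\<lambda>x. cdf P x - cdf Q x) (u / a))"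
  shows "has_bochner_integral lborel (\<lambda>w. (cmod (char P w - char Q w))\<^sup>2 / (w\<^sup>2 + a\<^sup>2))
    (pi * (LINT u|lborel. exp (- u) * indicator {0..} u * shift_energy (\<lambda>x. cdf P x - cdf Q x) (u / a)))"
proof -
  interpret P: real_distribution P by fact
  interpret Q: real_distribution Q by fact
  let ?J = "\<lambda>w. (cmod (char P w - char Q w))\<^sup>2"
  let ?D = "shift_energy (\<lambda>x. cdf P x - cdf Q x)"
  let ?f = "\<lambda>u. exp (- u) * indicator {0..} u * ?D (u / a)"
  \<comment> \<open>The form \<open>1 * u\<close> matches the exponential cosine integral at
    \<open>t = 1\<close>, \<open>b = w / a\<close>.\<close>
  let ?g = "\<lambda>u w. ennreal (?J w / w\<^sup>2) * (ennreal (exp (- (1 * u)) * (1 - cos (w / a * u))) * indicator {0..} u)"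
  have f_nonneg: "?f u \<ge> 0" for u
    by (auto simp: shift_energy_def indicator_def intro!: integral_nonneg_AE)
  have "(\<integral>\<^sup>+w. ennreal (?J w / (w\<^sup>2 + a\<^sup>2)) \<partial>lborel) = (\<integral>\<^sup>+w. (\<integral>\<^sup>+u. ?g u w \<partial>lborel) \<partial>lborel)"
  \<comment> \<open>The factors \<open>w\<^sup>2\<close> cancel only for nonzero
    \<open>w\<close>.\<close>
  proof (rule nn_integral_cong_AE, use AE_lborel_singleton[of 0] in eventually_elim)
    case (elim w)
    have "(\<integral>\<^sup>+u. ?g u w \<partial>lborel) = ennreal (?J w / w\<^sup>2) * ennreal ((w / a)\<^sup>2 / (1 * (1\<^sup>2 + (w / a)\<^sup>2)))"
      by (subst nn_integral_cmult) (auto simp only: nn_integral_exp_one_minus_cos zero_less_one, measurable)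
    also have "(w / a)\<^sup>2 / (1 * (1\<^sup>2 + (w / a)\<^sup>2)) = w\<^sup>2 / (w\<^sup>2 + a\<^sup>2)"
    proof -
      have "1 + (w / a)\<^sup>2 = (w\<^sup>2 + a\<^sup>2) / a\<^sup>2"
        using a by (simp add: field_simps)
      then show ?thesis
        using a by (simp add: power_divide)
    qed
    also have "ennreal (?J w / w\<^sup>2) * ennreal (w\<^sup>2 / (w\<^sup>2 + a\<^sup>2)) = ennreal (?J w / (w\<^sup>2 + a\<^sup>2))"
      using elim by (subst ennreal_mult[symmetric]) auto
    finally show ?case by simp
  qed
  also have "\<dots> = (\<integral>\<^sup>+u. (\<integral>\<^sup>+w. ?g u w \<partial>lborel) \<partial>lborel)"
    by (rule lborel_pair.Fubini') measurable
  also have "\<dots> = (\<integral>\<^sup>+u. ennreal (pi * ?f u) \<partial>lborel)"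
  proof (rule nn_integral_cong)
    fix u :: real
    show "(\<integral>\<^sup>+w. ?g u w \<partial>lborel) = ennreal (pi * ?f u)"
    proof (cases "u \<ge> 0")
      case True
      have E: "has_bochner_integral lborel (\<lambda>w. ?J w * ((1 - cos (u / a * w)) / w\<^sup>2)) (pi * ?D (u / a))"
        using True a by (intro has_bochner_integral_char_diff assms) simp
      have "(\<integral>\<^sup>+w. ?g u w \<partial>lborel)
          = (\<integral>\<^sup>+w. ennreal (exp (- u)) * ennreal (?J w * ((1 - cos (u / a * w)) / w\<^sup>2)) \<partial>lborel)"
        using True by (intro nn_integral_cong) (auto simp: ennreal_mult[symmetric] mult_ac)
      also have "\<dots> = ennreal (exp (- u)) * ennreal (pi * ?D (u / a))"
        using E by (subst nn_integral_cmult) (auto simp: has_bochner_integral_iff nn_integral_eq_integral)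
      also have "\<dots> = ennreal (pi * ?f u)"
        using True f_nonneg[of u] by (subst ennreal_mult[symmetric]) (auto simp: mult_ac zero_le_mult_iff)
      finally show ?thesis .
    qed simp
  qed
  also have "\<dots> = ennreal (pi * integral\<^sup>L lborel ?f)"
    using int f_nonneg by (subst nn_integral_eq_integral) (auto intro!: AE_I2 mult_nonneg_nonneg simp del: times_divide_eq_right)
  finally have "(\<integral>\<^sup>+w. ennreal (?J w / (w\<^sup>2 + a\<^sup>2)) \<partial>lborel) = ennreal (pi * integral\<^sup>L lborel ?f)" .
  moreover have "integral\<^sup>L lborel ?f \<ge> 0"
    by (intro integral_nonneg_AE AE_I2 f_nonneg)
  ultimately show ?thesis
    by (intro has_bochner_integral_nn_integral) auto
qed

section \<open>Translates of a square-integrable function\<close>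

lemma lborel_shift:
  fixes f :: "real \<Rightarrow> real"
  assumes "integrable lborel f"
  shows "integrable lborel (\<lambda>x. f (x + h))" and "(LINT x|lborel. f (x + h)) = integral\<^sup>L lborel f"
  using lborel_integrable_real_affine[OF assms, of 1 h] lborel_integral_real_affine[of 1 f h]
  by (simp_all add: add.commute)

locale square_integrable =
  fixes g :: "real \<Rightarrow> real"
  assumes borel_measurable [measurable]: "g \<in> borel_measurable borel"
    and integrable_square: "integrable lborel (\<lambda>x. (g x)\<^sup>2)"
begin

abbreviation energy :: real where "energy \<equiv> LINT x|lborel. (g x)\<^sup>2"

definition tail :: "real \<Rightarrow> real \<Rightarrow> real" where
  "tail m x = (g x)\<^sup>2 * indicator {x. m \<le> \<bar>x\<bar>} x"

lemma energy_nonneg: "energy \<ge> 0"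
  by (intro integral_nonneg_AE) auto

lemma borel_measurable_tail [measurable]: "tail m \<in> borel_measurable borel"
  unfolding tail_def[abs_def] by measurable

lemma integrable_tail: "integrable lborel (tail m)"
  unfolding tail_def
  by (rule Bochner_Integration.integrable_bound[OF integrable_square]) (auto simp: indicator_def)

text \<open>Dominated convergence with majorant \<open>(g x)\<^sup>2\<close>: at fixed
  \<open>x\<close> the tail is 0 once \<open>m > \<bar>x\<bar>\<close>.\<close>

lemma tail_tendsto: "((\<lambda>m. integral\<^sup>L lborel (tail m)) \<longlongrightarrow> 0) at_top"
proof -
  have "((\<lambda>m. integral\<^sup>L lborel (tail m)) \<longlongrightarrow> (LINT x|(lborel :: real measure). (0 :: real))) at_top"
  proof (rule integral_dominated_convergence_at_top[where s = tail and f = "\<lambda>_. 0" and M = lborel and w = "\<lambda>x. (g x)\<^sup>2"])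
    show "\<forall>\<^sub>F m in at_top. AE x in lborel. norm (tail m x) \<le> (g x)\<^sup>2"
      by (auto simp: tail_def indicator_def)
    show "AE x in lborel. ((\<lambda>m. tail m x) \<longlongrightarrow> 0) at_top"
    proof (rule AE_I2)
      fix x
      have "\<forall>\<^sub>F m in at_top. tail m x = 0"
        using eventually_gt_at_top[of "\<bar>x\<bar>"] by eventually_elim (auto simp: tail_def)
      then show "((\<lambda>m. tail m x) \<longlongrightarrow> 0) at_top"
        by (rule tendsto_eventually)
    qed
  qed (auto simp: integrable_square)
  then show ?thesis by simp
qed

lemma integrable_cross: "integrable lborel (\<lambda>x. g x * g (x + h))"
proof (rule Bochner_Integration.integrable_bound)
  show "integrable lborel (\<lambda>x. (g x)\<^sup>2 + (g (x + h))\<^sup>2)"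
    by (intro Bochner_Integration.integrable_add integrable_square lborel_shift(1)[of "\<lambda>x. (g x)\<^sup>2"])
  have "\<bar>a * b\<bar> \<le> a\<^sup>2 + b\<^sup>2" for a b :: real
    using sum_squares_bound[of "\<bar>a\<bar>" "\<bar>b\<bar>"] mult_nonneg_nonneg[OF abs_ge_zero abs_ge_zero, of a b]
    unfolding abs_mult power2_abs by linarith
  then show "AE x in lborel. norm (g x * g (x + h)) \<le> norm ((g x)\<^sup>2 + (g (x + h))\<^sup>2)"
    by simp
qed measurable

text \<open>Translation invariance gives both squares the same integral, so the limit of the shift
  energy depends only on the correlation of \<open>g\<close> with its translate.\<close>

lemma shift_energy_eq: "shift_energy g h = 2 * energy - 2 * (LINT x|lborel. g x * g (x + h))"
proof -
  note s = lborel_shift[OF integrable_square, of h]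
  have "shift_energy g h = (LINT x|lborel. (g (x + h))\<^sup>2 + (g x)\<^sup>2 - 2 * (g x * g (x + h)))"
    unfolding shift_energy_def by (intro Bochner_Integration.integral_cong) (auto simp: power2_diff)
  also have "\<dots> = energy + energy - 2 * (LINT x|lborel. g x * g (x + h))"
    using s integrable_square integrable_cross by simp
  finally show ?thesis by simp
qed

text \<open>For every \<open>x\<close>, one of \<open>x\<close> and \<open>x + h\<close> lies in the
  tail region. Young's inequality puts the weight \<open>1 / \<delta>\<close> on the factor there
  and the small weight \<open>\<delta>\<close> on the other.\<close>

lemma cross_bound:
  assumes "\<delta> > 0"
  shows "\<bar>2 * (LINT x|lborel. g x * g (x + h))\<bar> \<le> 2 * \<delta> * energy + 2 / \<delta> * integral\<^sup>L lborel (tail (h / 2))"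
proof -
  let ?T = "tail (h / 2)"
  \<comment> \<open>Symmetric in the two points, so one majorant covers both cases; by translation
    invariance each pair of terms integrates to twice one of them.\<close>
  let ?F = "\<lambda>x. \<delta> * ((g x)\<^sup>2 + (g (x + h))\<^sup>2) + 1 / \<delta> * (?T x + ?T (x + h))"
  note s = lborel_shift[OF integrable_square, of h]
  note t = lborel_shift[OF integrable_tail[of "h / 2"], of h]
  have F: "integrable lborel ?F"
    by (intro Bochner_Integration.integrable_add integrable_mult_right s t integrable_square integrable_tail)
  have "\<bar>2 * (LINT x|lborel. g x * g (x + h))\<bar> = \<bar>LINT x|lborel. 2 * (g x * g (x + h))\<bar>"
    by simp
  also have "\<dots> \<le> (LINT x|lborel. \<bar>2 * (g x * g (x + h))\<bar>)"
    by (rule integral_abs_bound)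
  also have "\<dots> \<le> integral\<^sup>L lborel ?F"
  proof (rule integral_mono)
    show "integrable lborel (\<lambda>x. \<bar>2 * (g x * g (x + h))\<bar>)"
      by (intro integrable_abs integrable_mult_right integrable_cross)
    show "integrable lborel ?F" by fact
    fix x :: real
    have weighted: "\<bar>2 * (a * b)\<bar> \<le> \<delta> * a\<^sup>2 + 1 / \<delta> * b\<^sup>2" for a b :: real
    proof -
      have "0 \<le> (\<delta> * \<bar>a\<bar> - \<bar>b\<bar>)\<^sup>2 / \<delta>"
        using assms by simp
      also have "\<dots> = \<delta> * a\<^sup>2 + 1 / \<delta> * b\<^sup>2 - \<bar>2 * (a * b)\<bar>"
        using assms by (simp add: power2_diff field_simps abs_mult power2_eq_square)
      finally show ?thesis by simp
    qed
    have nonneg: "0 \<le> ?T x" "0 \<le> ?T (x + h)" for x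
      by (auto simp: tail_def)
    consider "h / 2 \<le> \<bar>x\<bar>" | "h / 2 \<le> \<bar>x + h\<bar>"
      by linarith
    then show "\<bar>2 * (g x * g (x + h))\<bar> \<le> ?F x"
    proof cases
      case 1
      then have "?T x = (g x)\<^sup>2" by (simp add: tail_def)
      moreover have "\<delta> * (g x)\<^sup>2 \<ge> 0" "1 / \<delta> * ?T (x + h) \<ge> 0"
        using assms nonneg by auto
      ultimately show ?thesis
        using weighted[of "g (x + h)" "g x"] by (simp only: distrib_left mult.commute[of "g x"])
    next
      case 2
      then have "?T (x + h) = (g (x + h))\<^sup>2" by (simp add: tail_def)
      moreover have "\<delta> * (g (x + h))\<^sup>2 \<ge> 0" "1 / \<delta> * ?T x \<ge> 0"
        using assms nonneg by auto
      ultimately show ?thesis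
        using weighted[of "g x" "g (x + h)"] by (simp only: distrib_left)
    qed
  qed
  also have "\<dots> = \<delta> * (energy + energy) + 1 / \<delta> * (integral\<^sup>L lborel ?T + integral\<^sup>L lborel ?T)"
    using s t integrable_square integrable_tail[of "h / 2"]
    by (simp del: distrib_left_numeral times_divide_eq_left)
  finally show ?thesis by (simp add: algebra_simps)
qed

lemma shift_energy_tendsto: "(shift_energy g \<longlongrightarrow> 2 * energy) at_top"
proof (rule tendstoI)
  fix e :: real assume e: "e > 0"
  \<comment> \<open>This makes \<open>2 * \<delta> * energy\<close> equal to
    \<open>e / 2 - 2 * \<delta>\<close>; adding 1 to the energy avoids a zero denominator.\<close>
  define \<delta> where "\<delta> = e / (4 * (energy + 1))"
  have \<delta>: "\<delta> > 0"
    using e energy_nonneg unfolding \<delta>_def by (intro divide_pos_pos mult_pos_pos) linarith+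
  have "4 * (\<delta> * (energy + 1)) = e"
  proof -
    have "energy + 1 \<noteq> 0"
      using energy_nonneg by linarith
    then show ?thesis
      unfolding \<delta>_def by (metis nonzero_eq_divide_eq mult.assoc mult.commute mult_eq_0_iff zero_neq_numeral)
  qed
  then have small: "2 * \<delta> * energy < e / 2"
    using \<delta> by (simp add: algebra_simps)
  have "((\<lambda>h. integral\<^sup>L lborel (tail (h / 2))) \<longlongrightarrow> 0) at_top"
    by (rule filterlim_compose[OF tail_tendsto]) real_asymp
  \<comment> \<open>The threshold \<open>\<delta> * e / 4\<close> turns the tail term of
    \<open>cross_bound\<close> into less than \<open>e / 2\<close>.\<close>
  from order_tendstoD(2)[OF this, of "\<delta> * e / 4"]
  have "\<forall>\<^sub>F h in at_top. integral\<^sup>L lborel (tail (h / 2)) < \<delta> * e / 4"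
    using e \<delta> by simp
  then show "\<forall>\<^sub>F h in at_top. dist (shift_energy g h) (2 * energy) < e"
  proof eventually_elim
    case (elim h)
    have "2 / \<delta> * integral\<^sup>L lborel (tail (h / 2)) < e / 2"
      using elim \<delta> by (simp add: field_simps)
    then show ?case
      using cross_bound[OF \<delta>, of h] small unfolding shift_energy_eq dist_real_def by linarith
  qed
qed

text \<open>A bound uniform in \<open>h\<close>, from 2 |a b| \<le> a^2 + b^2; it gives the
  exponential averages an integrable majorant.\<close>

lemma shift_energy_bounds: "0 \<le> shift_energy g h" "shift_energy g h \<le> 4 * energy"
proof -
  show "0 \<le> shift_energy g h"
    unfolding shift_energy_def by (intro integral_nonneg_AE) auto
  note s = lborel_shift[OF integrable_square, of h]
  have "\<bar>2 * (LINT x|lborel. g x * g (x + h))\<bar> \<le> (LINT x|lborel. (g x)\<^sup>2 + (g (x + h))\<^sup>2)"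
  proof -
    have "\<bar>2 * (LINT x|lborel. g x * g (x + h))\<bar> = \<bar>LINT x|lborel. 2 * (g x * g (x + h))\<bar>"
      by simp
    also have "\<dots> \<le> (LINT x|lborel. \<bar>2 * (g x * g (x + h))\<bar>)"
      by (rule integral_abs_bound)
    also have "\<dots> \<le> (LINT x|lborel. (g x)\<^sup>2 + (g (x + h))\<^sup>2)"
    proof (rule integral_mono)
      fix x show "\<bar>2 * (g x * g (x + h))\<bar> \<le> (g x)\<^sup>2 + (g (x + h))\<^sup>2"
        using sum_squares_bound[of "\<bar>g x\<bar>" "\<bar>g (x + h)\<bar>"] by (simp add: abs_mult)
    qed (intro integrable_abs integrable_mult_right integrable_cross
        Bochner_Integration.integrable_add integrable_square s)+
    finally show ?thesis .
  qed
  also have "\<dots> = 2 * energy"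
    using s integrable_square by simp
  finally show "shift_energy g h \<le> 4 * energy"
    unfolding shift_energy_eq by linarith
qed

lemma borel_measurable_shift_energy [measurable]: "shift_energy g \<in> borel_measurable borel"
  unfolding shift_energy_def[abs_def] by measurable

text \<open>For each \<open>u > 0\<close> the shift \<open>u / a\<close> grows without bound as
  \<open>a\<close> shrinks, so the shift energy tends to \<open>2 * energy\<close>. The majorant
  \<open>4 * energy * exp (- u)\<close> on the half line carries the limit through the
  integral.\<close>

lemma exp_shift_energy:
  shows integrable_exp_shift_energy:
      "integrable lborel (\<lambda>u. exp (- u) * indicator {0..} u * shift_energy g (u / a))"
    and exp_shift_energy_tendsto:
      "(\<lambda>n. LINT u|lborel. exp (- u) * indicator {0..} u * shift_energy g (u / (1 / real (Suc n))))
        \<longlonglongrightarrow> 2 * energy"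
proof -
  let ?f = "\<lambda>a u. exp (- u) * indicator {0..} u * shift_energy g (u / a)"
  have exp: "has_bochner_integral lborel (\<lambda>u. exp (- u) * indicator {0..} u :: real) 1"
    \<comment> \<open>The weight has total mass 1, so averaging preserves the limit
      \<open>2 * energy\<close>.\<close>
    using has_bochner_integral_I0i_power_exp_m'[of 0] by simp
  then have exp_int: "integrable lborel (\<lambda>u. exp (- u) * indicator {0..} u * (4 * energy))"
    by (auto simp: has_bochner_integral_iff)
  have bound: "norm (?f a u) \<le> exp (- u) * indicator {0..} u * (4 * energy)" for a u
    using shift_energy_bounds[of "u / a"] by (auto simp: indicator_def abs_mult)
  show "integrable lborel (?f a)" for a
    by (rule Bochner_Integration.integrable_bound[OF exp_int])
      (use bound in \<open>auto intro!: AE_I2 order_trans[OF bound]\<close>)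
  have "(\<lambda>n. integral\<^sup>L lborel (?f (1 / real (Suc n)))) \<longlonglongrightarrow> (LINT u|lborel. exp (- u) * indicator {0..} u * (2 * energy))"
  proof (rule integral_dominated_convergence[OF _ _ exp_int])
    show "AE u in lborel. (\<lambda>n. ?f (1 / real (Suc n)) u) \<longlonglongrightarrow> exp (- u) * indicator {0..} u * (2 * energy)"
    \<comment> \<open>At \<open>u = 0\<close> the shift stays 0 and the integrand is 0 for every
      \<open>n\<close>, whatever the energy.\<close>
    proof (use AE_lborel_singleton[of 0] in eventually_elim)
      case (elim u)
      show ?case
      proof (cases "u > 0")
        case True
        then have "filterlim (\<lambda>n. u / (1 / real (Suc n))) at_top sequentially"
          by real_asymp
        then show ?thesis
          by (intro tendsto_intros filterlim_compose[OF shift_energy_tendsto])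
      qed (use elim in simp)
    qed
    show "AE u in lborel. norm (?f (1 / real (Suc n)) u) \<le> exp (- u) * indicator {0..} u * (4 * energy)" for n
      by (intro AE_I2 bound)
  qed measurable
  then show "(\<lambda>n. integral\<^sup>L lborel (?f (1 / real (Suc n)))) \<longlonglongrightarrow> 2 * energy"
    using exp by (simp add: has_bochner_integral_iff)
qed

end

section \<open>The identity with the singular weight\<close>

text \<open>Along \<open>a n = 1 / real (Suc n)\<close> the regularized integrands increase to the
  singular one while their integrals converge. Monotone convergence then yields integrability and
  the value together.\<close>

lemma has_bochner_integral_char_diff_div_square:
  assumes "real_distribution P" "real_distribution Q"
    and int: "integrable lborel (\<lambda>x. (cdf P x - cdf Q x)\<^sup>2)"
  shows "has_bochner_integral lborel (\<lambda>w. (cmod (char P w - char Q w))\<^sup>2 / w\<^sup>2)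
    (2 * pi * (LINT x|lborel. (cdf P x - cdf Q x)\<^sup>2))"
proof -
  interpret P: real_distribution P by fact
  interpret Q: real_distribution Q by fact
  interpret square_integrable "\<lambda>x. cdf P x - cdf Q x"
    by unfold_locales (use int in measurable)
  let ?J = "\<lambda>w. (cmod (char P w - char Q w))\<^sup>2"
  define a where "a n = 1 / real (Suc n)" for n
  have a: "a n > 0" for n by (simp add: a_def)
  note reg = has_bochner_integral_char_diff_regularized[OF assms(1,2) a integrable_exp_shift_energy]
  show ?thesis
  proof (rule has_bochner_integral_monotone_convergence)
    show "integrable lborel (\<lambda>w. ?J w / (w\<^sup>2 + (a n)\<^sup>2))" for n
      using reg[of n] by (simp add: has_bochner_integral_iff)
    have "a n \<le> a m" if "m \<le> n" for m n
      using that by (simp add: a_def frac_le)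
    then have "(a n)\<^sup>2 \<le> (a m)\<^sup>2" if "m \<le> n" for m n
      using a[of n] that by (intro power_mono) auto
    moreover have "(a n)\<^sup>2 > 0" for n
      using a[of n] by simp
    ultimately show "AE w in lborel. mono (\<lambda>n. ?J w / (w\<^sup>2 + (a n)\<^sup>2))"
      by (intro AE_I2 monoI divide_left_mono) (auto intro!: mult_pos_pos add_nonneg_pos)
    have "a \<longlonglongrightarrow> 0"
      unfolding a_def by real_asymp
    then show "AE w in lborel. (\<lambda>n. ?J w / (w\<^sup>2 + (a n)\<^sup>2)) \<longlonglongrightarrow> ?J w / w\<^sup>2"
      using AE_lborel_singleton[of 0] by (auto elim!: eventually_mono intro!: tendsto_eq_intros)
    have "(\<lambda>n. pi * (LINT u|lborel. exp (- u) * indicator {0..} u * shift_energy (\<lambda>x. cdf P x - cdf Q x) (u / a n)))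
        \<longlonglongrightarrow> pi * (2 * energy)"
      unfolding a_def by (intro tendsto_intros exp_shift_energy_tendsto)
    then show "(\<lambda>n. LINT w|lborel. ?J w / (w\<^sup>2 + (a n)\<^sup>2)) \<longlonglongrightarrow> 2 * pi * energy"
      using reg by (simp add: has_bochner_integral_iff mult_ac)
  qed measurable
qed

section \<open>Representatives and finiteness of the norms\<close>

text \<open>Reflexivity of the partial relation \<open>ae_eq\<close> amounts to measurability; it is
  the condition for evaluating lifted operations on a representative.\<close>

lemma ae_eq_char_minus_one:
  assumes "real_distribution P"
  shows "ae_eq (\<lambda>w. char P w - 1) (\<lambda>w. char P w - 1)"
proof -
  interpret real_distribution P by fact
  show ?thesis by (auto simp: ae_eq_def)
qed

lemma Phi_minus_Phi:
  assumes "real_distribution P1" "real_distribution P2"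
  shows "Phi P1 - Phi P2 = abs_ae_fun (\<lambda>w. char P1 w - char P2 w)"
  unfolding Phi_def
  by (simp add: minus_ae_fun.abs_eq[OF ae_eq_char_minus_one[OF assms(1)] ae_eq_char_minus_one[OF assms(2)]])

lemma ae_eq_char_diff:
  assumes "real_distribution P1" "real_distribution P2"
  shows "ae_eq (\<lambda>w. char P1 w - char P2 w) (\<lambda>w. char P1 w - char P2 w)"
proof -
  interpret P1: real_distribution P1 by fact
  interpret P2: real_distribution P2 by fact
  show ?thesis by (auto simp: ae_eq_def)
qed

text \<open>Rescaling by \<open>sqrt \<epsilon>\<close> reduces the claim to
  \<open>inverse (1 + w\<^sup>2)\<close>.\<close>

lemma integrable_inverse_square_plus:
  fixes \<epsilon> :: real
  assumes "\<epsilon> > 0"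
  shows "integrable lborel (\<lambda>w. 1 / (w\<^sup>2 + \<epsilon>))"
proof -
  have "integrable lborel (\<lambda>w :: real. inverse (1 + w\<^sup>2))"
    using integrable_inverse_1_plus_square by (simp add: set_integrable_def)
  from lborel_integrable_real_affine[OF this, of "1 / sqrt \<epsilon>" 0]
  have "integrable lborel (\<lambda>w. (1 / \<epsilon>) * inverse (1 + (w / sqrt \<epsilon>)\<^sup>2))"
    using assms by (intro integrable_mult_right) simp
  also have "(\<lambda>w. (1 / \<epsilon>) * inverse (1 + (w / sqrt \<epsilon>)\<^sup>2)) = (\<lambda>w. 1 / (w\<^sup>2 + \<epsilon>))"
  proof
    fix w
    have "1 + (w / sqrt \<epsilon>)\<^sup>2 = (w\<^sup>2 + \<epsilon>) / \<epsilon>"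
      using assms by (simp add: power_divide field_simps)
    then show "(1 / \<epsilon>) * inverse (1 + (w / sqrt \<epsilon>)\<^sup>2) = 1 / (w\<^sup>2 + \<epsilon>)"
      using assms by simp
  qed
  finally show ?thesis .
qed

text \<open>Applied with bound 2 to \<open>char P w - 1\<close> and to differences of characteristic
  functions, this gives membership in \<open>H_space\<close>.\<close>

lemma integrable_bounded_weighted:
  assumes "\<epsilon> > 0" and [measurable]: "f \<in> borel_measurable borel" and bound: "\<And>w. cmod (f w) \<le> B"
  shows "integrable lborel (\<lambda>w. (cmod (f w))\<^sup>2 / (w\<^sup>2 + \<epsilon>))"
proof (rule Bochner_Integration.integrable_bound)
  show "integrable lborel (\<lambda>w. B\<^sup>2 * (1 / (w\<^sup>2 + \<epsilon>)))"
    using assms(1) by (intro integrable_mult_right integrable_inverse_square_plus)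
  have "norm ((cmod (f w))\<^sup>2 / (w\<^sup>2 + \<epsilon>)) \<le> norm (B\<^sup>2 * (1 / (w\<^sup>2 + \<epsilon>)))" for w
    using assms(1) power_mono[OF bound[of w] norm_ge_zero, of 2]
    by (auto simp: add_nonneg_pos intro!: divide_right_mono)
  then show "AE w in lborel. norm ((cmod (f w))\<^sup>2 / (w\<^sup>2 + \<epsilon>)) \<le> norm (B\<^sup>2 * (1 / (w\<^sup>2 + \<epsilon>)))"
    by simp
qed measurable

text \<open>The reference \<open>cdf_delta0\<close> cancels in the difference, and (a - b)^2 \<le> 2
  a^2 + 2 b^2.\<close>

lemma integrable_cdf_diff_square:
  assumes "cdf P1 \<in> Gamma_F" "cdf P2 \<in> Gamma_F"
  shows "integrable lborel (\<lambda>x. (cdf P1 x - cdf P2 x)\<^sup>2)"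
proof -
  have [measurable]: "(\<lambda>x. cdf P x - cdf_delta0 x) \<in> borel_measurable borel"
    and int: "integrable lborel (\<lambda>x. (cdf P x - cdf_delta0 x)\<^sup>2)" if "cdf P \<in> Gamma_F" for P
    using that by (auto simp: Gamma_F_def L2_real_def)
  have "integrable lborel (\<lambda>x. ((cdf P1 x - cdf_delta0 x) - (cdf P2 x - cdf_delta0 x))\<^sup>2)"
  proof (rule Bochner_Integration.integrable_bound)
    show "integrable lborel (\<lambda>x. 2 * (cdf P1 x - cdf_delta0 x)\<^sup>2 + 2 * (cdf P2 x - cdf_delta0 x)\<^sup>2)"
      using assms by (intro Bochner_Integration.integrable_add integrable_mult_right int)
    have "(a - b)\<^sup>2 \<le> 2 * a\<^sup>2 + 2 * b\<^sup>2" for a b :: real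
      using zero_le_power2[of "a + b"] by (simp add: power2_sum power2_diff)
    then have "norm ((a - b)\<^sup>2) \<le> norm (2 * a\<^sup>2 + 2 * b\<^sup>2)" for a b :: real
      unfolding real_norm_def abs_power2 by (rule order_trans[OF _ abs_ge_self])
    then show "AE x in lborel. norm (((cdf P1 x - cdf_delta0 x) - (cdf P2 x - cdf_delta0 x))\<^sup>2)
        \<le> norm (2 * (cdf P1 x - cdf_delta0 x)\<^sup>2 + 2 * (cdf P2 x - cdf_delta0 x)\<^sup>2)"
      by (intro AE_I2)
  qed (use assms in measurable)
  then show ?thesis by simp
qed

section \<open>Monotone limit and the Cramer distance\<close>

text \<open>A divergent Bochner integral has value 0, so membership and integrability are asserted
  beside the equations to ensure that every integral is genuine. The upward arrow is split into
  monotonicity and a limit at \<open>at_right 0\<close>.\<close>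

theorem proposition4:
  fixes P1 P2 :: "real measure"
  assumes "real_distribution P1" and "real_distribution P2"
    and "cdf P1 \<in> Gamma_F" and "cdf P2 \<in> Gamma_F"
  shows "(\<forall>\<epsilon>>0. Phi P1 \<in> H_space \<epsilon> \<and> Phi P2 \<in> H_space \<epsilon> \<and> Phi P1 - Phi P2 \<in> H_space \<epsilon> \<and>
            integrable lborel (\<lambda>\<omega>. (cmod (char P1 \<omega> - char P2 \<omega>))\<^sup>2 / (\<omega>\<^sup>2 + \<epsilon>)) \<and>
            (H_norm \<epsilon> (Phi P1 - Phi P2))\<^sup>2
              = 1 / (2 * pi) * (LINT \<omega>|lborel. (cmod (char P1 \<omega> - char P2 \<omega>))\<^sup>2 / (\<omega>\<^sup>2 + \<epsilon>))) \<and>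
         (\<forall>\<epsilon> \<epsilon>'. 0 < \<epsilon> \<longrightarrow> \<epsilon> \<le> \<epsilon>' \<longrightarrow>
            H_norm \<epsilon>' (Phi P1 - Phi P2) \<le> H_norm \<epsilon> (Phi P1 - Phi P2)) \<and>
         ((\<lambda>\<epsilon>. H_norm \<epsilon> (Phi P1 - Phi P2)) \<longlongrightarrow>
            sqrt (1 / (2 * pi) * (LINT \<omega>|lborel. (cmod (char P1 \<omega> - char P2 \<omega>))\<^sup>2 / \<omega>\<^sup>2)))
            (at_right 0) \<and>
         integrable lborel (\<lambda>\<omega>. (cmod (char P1 \<omega> - char P2 \<omega>))\<^sup>2 / \<omega>\<^sup>2) \<and>
         integrable lborel (\<lambda>x. (cdf P1 x - cdf P2 x)\<^sup>2) \<and>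
         sqrt (1 / (2 * pi) * (LINT \<omega>|lborel. (cmod (char P1 \<omega> - char P2 \<omega>))\<^sup>2 / \<omega>\<^sup>2))
           = cramer_dist P1 P2"
proof -
  interpret P1: real_distribution P1 by fact
  interpret P2: real_distribution P2 by fact
  let ?J = "\<lambda>w. (cmod (char P1 w - char P2 w))\<^sup>2"
  have cdf_int: "integrable lborel (\<lambda>x. (cdf P1 x - cdf P2 x)\<^sup>2)"
    by (rule integrable_cdf_diff_square) fact+
  have J_int: "integrable lborel (\<lambda>w. ?J w / w\<^sup>2)"
    and J_eq: "(LINT w|lborel. ?J w / w\<^sup>2) = 2 * pi * (LINT x|lborel. (cdf P1 x - cdf P2 x)\<^sup>2)"
    using has_bochner_integral_char_diff_div_square[OF assms(1,2) cdf_int]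
    by (auto simp: has_bochner_integral_iff)
  have H_norm: "H_norm \<epsilon> (Phi P1 - Phi P2) = sqrt (1 / (2 * pi) * (LINT w|lborel. ?J w / (w\<^sup>2 + \<epsilon>)))" for \<epsilon>
    unfolding Phi_minus_Phi[OF assms(1,2)] by (rule H_norm.abs_eq[OF ae_eq_char_diff[OF assms(1,2)]])
  have le2: "cmod (char P1 w - 1) \<le> 2" "cmod (char P2 w - 1) \<le> 2" "cmod (char P1 w - char P2 w) \<le> 2" for w
    using norm_triangle_ineq4[of "char P1 w" 1] norm_triangle_ineq4[of "char P2 w" 1]
      norm_triangle_ineq4[of "char P1 w" "char P2 w"] P1.cmod_char_le_1[of w] P2.cmod_char_le_1[of w]
    by auto
  have J_reg: "integrable lborel (\<lambda>w. ?J w / (w\<^sup>2 + \<epsilon>))" if "\<epsilon> > 0" for \<epsilon>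
    using that le2(3) by (intro integrable_bounded_weighted) auto
  have "Phi P1 \<in> H_space \<epsilon>" "Phi P2 \<in> H_space \<epsilon>" "Phi P1 - Phi P2 \<in> H_space \<epsilon>" if "\<epsilon> > 0" for \<epsilon>
  proof -
    show "Phi P1 \<in> H_space \<epsilon>" "Phi P2 \<in> H_space \<epsilon>"
      using that le2 unfolding H_space_def Phi_def
      by (simp_all add: H_member.abs_eq ae_eq_char_minus_one assms integrable_bounded_weighted[where B = 2])
    show "Phi P1 - Phi P2 \<in> H_space \<epsilon>"
      using that unfolding H_space_def Phi_minus_Phi[OF assms(1,2)]
      by (simp add: H_member.abs_eq ae_eq_char_diff assms J_reg)
  qed
  moreover have "(H_norm \<epsilon> (Phi P1 - Phi P2))\<^sup>2 = 1 / (2 * pi) * (LINT w|lborel. ?J w / (w\<^sup>2 + \<epsilon>))"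
    if "\<epsilon> > 0" for \<epsilon>
  proof -
    have "(LINT w|lborel. ?J w / (w\<^sup>2 + \<epsilon>)) \<ge> 0"
      using that by (intro integral_nonneg_AE AE_I2 divide_nonneg_nonneg) auto
    then show ?thesis
      unfolding H_norm by (intro real_sqrt_pow2 mult_nonneg_nonneg) auto
  qed
  moreover have "H_norm \<epsilon>' (Phi P1 - Phi P2) \<le> H_norm \<epsilon> (Phi P1 - Phi P2)" if "0 < \<epsilon>" "\<epsilon> \<le> \<epsilon>'" for \<epsilon> \<epsilon>'
  proof -
    have "(LINT w|lborel. ?J w / (w\<^sup>2 + \<epsilon>')) \<le> (LINT w|lborel. ?J w / (w\<^sup>2 + \<epsilon>))"
      using that by (intro integral_mono J_reg divide_left_mono mult_pos_pos add_nonneg_pos) auto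
    then show ?thesis
      unfolding H_norm by (intro real_sqrt_le_mono mult_left_mono) auto
  qed
  moreover have "((\<lambda>\<epsilon>. H_norm \<epsilon> (Phi P1 - Phi P2)) \<longlongrightarrow> sqrt (1 / (2 * pi) * (LINT w|lborel. ?J w / w\<^sup>2))) (at_right 0)"
    unfolding H_norm
  \<comment> \<open>Passing to sequences makes dominated convergence applicable; 1 is an arbitrary
    right endpoint.\<close>
  proof (intro tendsto_intros tendsto_at_right_sequentially[of 0 1])
    fix S :: "nat \<Rightarrow> real" assume S: "\<And>n. 0 < S n" "S \<longlonglongrightarrow> 0"
    show "(\<lambda>n. LINT w|lborel. ?J w / (w\<^sup>2 + S n)) \<longlonglongrightarrow> (LINT w|lborel. ?J w / w\<^sup>2)"
    \<comment> \<open>The majorant is the limit integrand itself, integrable by the singular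
      identity; the comparison is made away from \<open>w = 0\<close>.\<close>
    proof (rule integral_dominated_convergence[OF _ _ J_int])
      show "AE w in lborel. (\<lambda>n. ?J w / (w\<^sup>2 + S n)) \<longlonglongrightarrow> ?J w / w\<^sup>2"
        using AE_lborel_singleton[of 0] S(2) by (auto elim!: eventually_mono intro!: tendsto_eq_intros)
      have "norm (?J w / (w\<^sup>2 + S n)) \<le> ?J w / w\<^sup>2" if "w \<noteq> 0" for w n
      proof -
        have "?J w / (w\<^sup>2 + S n) \<le> ?J w / w\<^sup>2"
          using that S(1)[of n] by (intro divide_left_mono mult_pos_pos add_nonneg_pos) auto
        then show ?thesis
          using S(1)[of n] by (simp add: add_nonneg_pos)
      qed
      then show "AE w in lborel. norm (?J w / (w\<^sup>2 + S n)) \<le> ?J w / w\<^sup>2" for n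
        using AE_lborel_singleton[of 0] by (auto elim!: eventually_mono)
    qed measurable
  qed simp
  moreover have "sqrt (1 / (2 * pi) * (LINT w|lborel. ?J w / w\<^sup>2)) = cramer_dist P1 P2"
    unfolding J_eq cramer_dist_def by simp
  ultimately show ?thesis
    using J_reg J_int cdf_int by blast
qed

end
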